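(* Let $M\in\mathbb{C}^{p\times p}$ be nonsingular, let $\mathcal{A}\in\mathbb{C}^{m\times m\times p}$ be invertible and $\mathcal{B}\in\mathbb{C}^{m\times 1\times p}$. Let $\mathcal{A}=\mathcal{P}-\mathcal{Q}$ be a splitting with $\mathcal{P},\mathcal{Q}\in\mathbb{C}^{m\times m\times p}$ and $\mathcal{P}$ invertible, and put $\mathcal{T}=\mathcal{P}^{-1}*_M\mathcal{Q}$ and $\mathcal{C}=\mathcal{P}^{-1}*_M\mathcal{B}$. Then the iterative method $$\mathcal{X}^{s}=\mathcal{T}*_M\mathcal{X}^{s-1}+\mathcal{C},\qquad s=1,2,\ldots,$$ converges to $\mathcal{A}^{-1}*_M\mathcal{B}$ for every initial $\mathcal{X}^{0}\in\mathbb{C}^{m\times 1\times p}$ if and only if $\rho(\mathcal{T})<1$.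
   Context: Transform: for $\mathcal{A}\in\mathbb{C}^{m\times n\times p}$, $\tilde{\mathcal{A}}=\mathcal{A}\times_3 M\in\mathbb{C}^{m\times n\times p}$ is given by $(\tilde{\mathcal{A}})_{ijk}=\sum_{s=1}^p(\mathcal{A})_{ijs}M_{ks}$, and $\tilde{\mathcal{A}}^{(i)}=\tilde{\mathcal{A}}(:,:,i)$ is its $i$th frontal slice. Since $M$ is nonsingular, $\mathcal{A}\mapsto\tilde{\mathcal{A}}$ is a bijection. $M$-product: for $\mathcal{A}\in\mathbb{C}^{m\times n\times p}$, $\mathcal{B}\in\mathbb{C}^{n\times l\times p}$, $\mathcal{A}*_M\mathcal{B}$ is the unique $\mathcal{C}\in\mathbb{C}^{m\times l\times p}$ with $\tilde{\mathcal{C}}^{(i)}=\tilde{\mathcal{A}}^{(i)}\tilde{\mathcal{B}}^{(i)}$, $i=1,\dots,p$. The identity tensor $\mathcal{I}$ has $\tilde{\mathcal{I}}^{(i)}=I_m$ for all $i$. A tensor $\mathcal{A}\in\mathbb{C}^{m\times m\times p}$ is invertible, with inverse $\mathcal{A}^{-1}=\mathcal{X}$, if $\mathcal{A}*_M\mathcal{X}=\mathcal{X}*_M\mathcal{A}=\mathcal{I}$. Here $\mathcal{X}^{s}$ denotes the $s$th iterate (not a power); convergence of the iterates is entrywise convergence. Spectral radius of a tensor: $\rho(\mathcal{T})=\max_{1\le i\le p}\rho(\tilde{\mathcal{T}}^{(i)})$, the maximum of the usual spectral radii of the frontal slices of $\tilde{\mathcal{T}}$. *)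

theory Defs
  imports "HOL-Analysis.Analysis"
begin

text \<open>
  A tensor in \<open>\<complex>\<^sup>m\<^sup>\<times>\<^sup>n\<^sup>\<times>\<^sup>p\<close> is stored as the family of its frontal slices: the entry with
  indices \<open>i, j, k\<close> is \<open>A $ k $ i $ j\<close>, and \<open>A $ k\<close> is the \<open>m \<times> n\<close> matrix \<open>A(:,:,k)\<close>.
\<close>

type_synonym ('m, 'n, 'p) tensor = "(((complex, 'n) vec, 'm) vec, 'p) vec"

definition tensor_transform ::
    "complex ^ 'p ^ 'p \<Rightarrow> ('m::finite, 'n::finite, 'p::finite) tensor \<Rightarrow> ('m, 'n, 'p) tensor" where
  "tensor_transform M A = (\<chi> k i j. \<Sum>s\<in>UNIV. A $ s $ i $ j * M $ k $ s)"

text \<open>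
  The definite descriptions in this theory are meaningful for nonsingular \<open>M\<close>, when
  the transform is a bijection.
\<close>

definition m_product ::
    "complex ^ 'p ^ 'p \<Rightarrow> ('m::finite, 'n::finite, 'p::finite) tensor \<Rightarrow> ('n, 'l::finite, 'p) tensor
      \<Rightarrow> ('m, 'l, 'p) tensor" where
  "m_product M A B =
     (THE C. \<forall>k. tensor_transform M C $ k = tensor_transform M A $ k ** tensor_transform M B $ k)"

definition m_identity :: "complex ^ 'p ^ 'p \<Rightarrow> ('m::finite, 'm, 'p::finite) tensor" where
  "m_identity M = (THE I. \<forall>k. tensor_transform M I $ k = mat 1)"

definition is_m_inverse ::
    "complex ^ 'p ^ 'p \<Rightarrow> ('m::finite, 'm, 'p::finite) tensor \<Rightarrow> ('m, 'm, 'p) tensor \<Rightarrow> bool" where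
  "is_m_inverse M A X \<longleftrightarrow> m_product M A X = m_identity M \<and> m_product M X A = m_identity M"

definition m_invertible ::
    "complex ^ 'p ^ 'p \<Rightarrow> ('m::finite, 'm, 'p::finite) tensor \<Rightarrow> bool" where
  "m_invertible M A \<longleftrightarrow> (\<exists>X. is_m_inverse M A X)"

definition m_inverse ::
    "complex ^ 'p ^ 'p \<Rightarrow> ('m::finite, 'm, 'p::finite) tensor \<Rightarrow> ('m, 'm, 'p) tensor" where
  "m_inverse M A = (THE X. is_m_inverse M A X)"

definition matrix_spectrum :: "complex ^ 'n ^ 'n \<Rightarrow> complex set" where
  "matrix_spectrum A = {\<mu>. \<exists>v. v \<noteq> 0 \<and> A *v v = \<mu> *s v}"

definition matrix_spectral_radius :: "complex ^ 'n ^ 'n \<Rightarrow> real" where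
  "matrix_spectral_radius A = Max (cmod ` matrix_spectrum A)"

definition tensor_spectral_radius ::
    "complex ^ 'p ^ 'p \<Rightarrow> ('m::finite, 'm, 'p::finite) tensor \<Rightarrow> real" where
  "tensor_spectral_radius M T = Max (range (\<lambda>k. matrix_spectral_radius (tensor_transform M T $ k)))"

primrec m_iterate ::
    "complex ^ 'p ^ 'p \<Rightarrow> ('m::finite, 'm, 'p::finite) tensor \<Rightarrow> ('m, 'n::finite, 'p) tensor
      \<Rightarrow> ('m, 'n, 'p) tensor \<Rightarrow> nat \<Rightarrow> ('m, 'n, 'p) tensor" where
  "m_iterate M T C X0 0 = X0"
| "m_iterate M T C X0 (Suc s) = m_product M T (m_iterate M T C X0 s) + C"

definition tensor_converges ::
    "(nat \<Rightarrow> ('m::finite, 'n::finite, 'p::finite) tensor) \<Rightarrow> ('m, 'n, 'p) tensor \<Rightarrow> bool" where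
  "tensor_converges X L \<longleftrightarrow> (\<forall>i j k. (\<lambda>s. X s $ k $ i $ j) \<longlonglongrightarrow> L $ k $ i $ j)"

lemma tensor_converges_iff_LIMSEQ: "tensor_converges X L \<longleftrightarrow> X \<longlonglongrightarrow> L"
proof
  assume "tensor_converges X L"
  then have "(\<lambda>s. X s $ k $ i $ j) \<longlonglongrightarrow> L $ k $ i $ j" for i j k
    unfolding tensor_converges_def by blast
  then have "(\<lambda>s. X s $ k $ i) \<longlonglongrightarrow> L $ k $ i" for i k
    by (rule vec_tendstoI)
  then have "(\<lambda>s. X s $ k) \<longlonglongrightarrow> L $ k" for k
    by (rule vec_tendstoI)
  then show "X \<longlonglongrightarrow> L"
    by (rule vec_tendstoI)
next
  assume X: "X \<longlonglongrightarrow> L"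
  show "tensor_converges X L"
    unfolding tensor_converges_def
    by (intro allI) (rule tendsto_vec_nth[OF tendsto_vec_nth[OF tendsto_vec_nth[OF X]]])
qed

lemma tensor_transform_inverse:
  assumes "M ** N = mat 1"
  shows "tensor_transform M (tensor_transform N A) = A"
proof -
  have MN: "(\<Sum>s\<in>UNIV. M $ k $ s * N $ s $ t) = (if k = t then 1 else 0)" for k t
    using arg_cong[OF assms, of "\<lambda>X. X $ k $ t"] by (simp add: matrix_matrix_mult_def mat_def)
  have "(\<Sum>s\<in>UNIV. (\<Sum>t\<in>UNIV. A $ t $ i $ j * N $ s $ t) * M $ k $ s) = A $ k $ i $ j" for i j k
  proof -
    have "(\<Sum>s\<in>UNIV. (\<Sum>t\<in>UNIV. A $ t $ i $ j * N $ s $ t) * M $ k $ s)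
        = (\<Sum>t\<in>UNIV. A $ t $ i $ j * (\<Sum>s\<in>UNIV. M $ k $ s * N $ s $ t))"
      unfolding sum_distrib_left sum_distrib_right
      by (subst sum.swap) (simp only: mult_ac)
    also have "\<dots> = A $ k $ i $ j"
      by (simp add: MN if_distrib[of "\<lambda>x. _ * x"] cong: if_cong)
    finally show ?thesis .
  qed
  then show ?thesis
    by (simp add: tensor_transform_def vec_eq_iff)
qed

lemma bij_tensor_transform:
  assumes "invertible M"
  shows "bij (tensor_transform M)"
proof -
  obtain N where "M ** N = mat 1" "N ** M = mat 1"
    using assms by (auto simp: invertible_def)
  then show ?thesis
    by (intro o_bij[of "tensor_transform N"]) (auto simp: tensor_transform_inverse fun_eq_iff)
qed

lemma ex1_tensor_transform:
  assumes "invertible M"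
  shows "\<exists>!C. \<forall>k. tensor_transform M C $ k = F k"
proof -
  have "\<exists>!C. tensor_transform M C = (\<chi> k. F k)"
    using bij_tensor_transform[OF assms] unfolding bij_iff by blast
  then show ?thesis by (simp add: vec_eq_iff)
qed

lemma tensor_transform_m_product:
  assumes "invertible M"
  shows "tensor_transform M (m_product M A B) $ k = tensor_transform M A $ k ** tensor_transform M B $ k"
  using theI'[OF ex1_tensor_transform[OF assms,
      of "\<lambda>k. tensor_transform M A $ k ** tensor_transform M B $ k"]]
  unfolding m_product_def by (rule spec)

lemma tensor_transform_m_identity:
  assumes "invertible M"
  shows "tensor_transform M (m_identity M) $ k = mat 1"
  using theI'[OF ex1_tensor_transform[OF assms, of "\<lambda>k. mat 1"]]
  unfolding m_identity_def by (rule spec)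

lemma tensor_eqI:
  assumes "invertible M" "\<And>k. tensor_transform M A $ k = tensor_transform M B $ k"
  shows "A = B"
proof -
  have "tensor_transform M A = tensor_transform M B"
    by (subst vec_eq_iff) (simp add: assms(2))
  then show ?thesis
    using bij_is_inj[OF bij_tensor_transform[OF assms(1)]] by (rule injD[rotated])
qed

lemma is_m_inverse_unique:
  assumes M: "invertible M" and "is_m_inverse M A X" "is_m_inverse M A Y"
  shows "X = Y"
proof (rule tensor_eqI[OF M])
  fix k
  let ?a = "tensor_transform M A $ k" and ?x = "tensor_transform M X $ k"
    and ?y = "tensor_transform M Y $ k"
  have "?x ** ?a = mat 1" "?a ** ?y = mat 1"
    using assms(2,3) tensor_transform_m_product[OF M, of X A k]
      tensor_transform_m_product[OF M, of A Y k]
    by (simp_all add: is_m_inverse_def tensor_transform_m_identity[OF M])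
  then show "?x = ?y"
    using matrix_mul_assoc[of ?x ?a ?y] by simp
qed

lemma is_m_inverse_m_inverse:
  assumes "invertible M" "m_invertible M A"
  shows "is_m_inverse M A (m_inverse M A)"
proof -
  have "\<exists>!X. is_m_inverse M A X"
    using assms(2) is_m_inverse_unique[OF assms(1)] unfolding m_invertible_def by blast
  then show ?thesis
    unfolding m_inverse_def by (rule theI')
qed

end

theory Submission
  imports Defs "HOL-Computational_Algebra.Fundamental_Theorem_Algebra"
begin

text \<open>
  The transform turns the \<open>M\<close>-product into slicewise matrix multiplication and is a linear
  homeomorphism, so convergence can be tested on the transformed slices. There the limit
  \<open>L = A\<^sup>-\<^sup>1 *\<^sub>M B\<close> is a fixed point of \<open>X \<mapsto> T *\<^sub>M X + C\<close> (lemma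
  \<open>solution_fixed_point\<close>: multiply \<open>P L = Q L + B\<close> by the inverse of \<open>P\<close>), so the error of the
  \<open>s\<close>-th iterate in slice \<open>k\<close> is the \<open>s\<close>-th power of the \<open>k\<close>-th slice \<open>T\<^sub>k\<close> of the
  transformed \<open>T\<close> times the initial error. The initial error being arbitrary, the method converges
  for every start iff \<open>T\<^sub>k\<^sup>s v \<longlonglongrightarrow> 0\<close> for all \<open>k\<close> and \<open>v\<close> (\<open>m_iterate_converges_iff\<close>).

  It remains to see that the powers of a complex matrix \<open>A\<close> tend to zero on every vector iff all
  eigenvalues lie in the open unit disc (\<open>matrix_powers_tendsto_0_iff\<close>). An eigenvector shows
  necessity. For sufficiency, the powers of \<open>A\<close> are linearly dependent, so
  some nonzero polynomial annihilates \<open>A\<close>, and by the fundamental theorem of algebra some product of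
  shifts \<open>A - l\<close> vanishes. Hence it is enough that a single shift can be cancelled: if
  \<open>A\<^sup>k (A - l) u \<longlonglongrightarrow> 0\<close> then \<open>A\<^sup>k u \<longlonglongrightarrow> 0\<close>
  (\<open>matrix_powers_shift_tendsto_0\<close>). The same vanishing product shows that the spectrum is finite
  and nonempty, so that the maximum defining the spectral radius is a true maximum.
\<close>

section \<open>A product of shifts that annihilates a matrix\<close>

primrec matrix_power :: "'a::semiring_1 ^ 'n ^ 'n \<Rightarrow> nat \<Rightarrow> 'a ^ 'n ^ 'n" where
  "matrix_power A 0 = mat 1"
| "matrix_power A (Suc k) = A ** matrix_power A k"

lemma matrix_power_commute_vec:
  "matrix_power A k *v (A *v v) = A *v (matrix_power A k *v v)"
  by (induction k) (simp_all flip: matrix_vector_mul_assoc)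

text \<open>The vector \<open>p(A) v\<close>, evaluated by the Horner scheme so that induction on \<open>p\<close> applies.\<close>

definition poly_matrix_vec :: "complex poly \<Rightarrow> complex ^ 'n ^ 'n \<Rightarrow> complex ^ 'n \<Rightarrow> complex ^ 'n" where
  "poly_matrix_vec p A v = fold_coeffs (\<lambda>a w. a *s v + A *v w) p 0"

lemma poly_matrix_vec_0 [simp]: "poly_matrix_vec 0 A v = 0"
  by (simp add: poly_matrix_vec_def)

lemma poly_matrix_vec_pCons [simp]:
  "poly_matrix_vec (pCons a p) A v = a *s v + A *v poly_matrix_vec p A v"
  by (cases "a = 0 \<and> p = 0") (auto simp: poly_matrix_vec_def)

lemma poly_matrix_vec_add:
  "poly_matrix_vec (p + q) A v = poly_matrix_vec p A v + poly_matrix_vec q A v"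
  by (induction p q rule: poly_induct2) (simp_all add: vector_sadd_rdistrib matrix_vector_right_distrib)

lemma poly_matrix_vec_sum:
  "poly_matrix_vec (sum f S) A v = (\<Sum>i\<in>S. poly_matrix_vec (f i) A v)"
  by (induction S rule: infinite_finite_induct) (simp_all add: poly_matrix_vec_add)

lemma poly_matrix_vec_smult:
  "poly_matrix_vec (smult c p) A v = c *s poly_matrix_vec p A v"
  by (induction p) (simp_all add: vector_add_ldistrib vector_smult_assoc vector_scalar_commute)

lemma poly_matrix_vec_monom:
  "poly_matrix_vec (monom c k) A v = c *s (matrix_power A k *v v)"
  by (induction k)
    (simp_all add: monom_0 monom_Suc vector_scalar_commute flip: matrix_vector_mul_assoc)

text \<open>
  Evaluating a product of linear factors at \<open>A\<close> applies the shifts \<open>A - l\<close> one after the other.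
  This form is what the later inductions peel off factor by factor.
\<close>

lemma poly_matrix_vec_prod_list:
  "poly_matrix_vec (\<Prod>l\<leftarrow>ls. [:- l, 1:]) A v = foldr (\<lambda>l w. A *v w - l *s w) ls v"
proof (induction ls)
  case Nil
  then show ?case by (simp add: one_pCons)
next
  case (Cons l ls)
  have split: "[:- l, 1:] * q = smult (- l) q + pCons 0 q" for q :: "complex poly"
    by simp
  show ?case using Cons
    by (simp only: list.map prod_list.Cons split poly_matrix_vec_add poly_matrix_vec_smult
        poly_matrix_vec_pCons foldr.simps o_apply)
      simp
qed

text \<open>
  The matrices form a finite-dimensional space, so their infinitely many powers cannot be independent.
  Real coefficients already suffice for the dependence. If two powers coincide, then the set of
  powers may be independent, and the difference of the two monomials is taken instead.
\<close>

lemma ex_annihilating_poly: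
  fixes A :: "complex ^ 'n ^ 'n"
  shows "\<exists>p. p \<noteq> 0 \<and> (\<forall>v. poly_matrix_vec p A v = 0)"
proof (cases "inj (matrix_power A)")
  case False
  then obtain i j where ij: "i \<noteq> j" "matrix_power A i = matrix_power A j"
    by (auto simp: inj_def)
  let ?p = "monom 1 i + monom (- 1) j :: complex poly"
  have "coeff ?p i \<noteq> 0"
    using ij(1) by simp
  then have "?p \<noteq> 0"
    by (metis coeff_0)
  moreover have "poly_matrix_vec ?p A v = 0" for v
    using ij(2) by (simp add: poly_matrix_vec_add poly_matrix_vec_monom)
  ultimately show ?thesis by blast
next
  case inj: True
  have "infinite (range (matrix_power A))"
    using inj by (simp add: finite_image_iff)
  then have "dependent (range (matrix_power A))"
    using independent_bound by blast
  then obtain t u X where t: "finite t" "t \<subseteq> range (matrix_power A)"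
    and u: "(\<Sum>X\<in>t. u X *\<^sub>R X) = 0" "X \<in> t" "u X \<noteq> 0"
    unfolding dependent_explicit by blast
  obtain I where I: "finite I" "t = matrix_power A ` I"
    using finite_subset_image[OF t] by blast
  define c where "c i = complex_of_real (u (matrix_power A i))" for i
  let ?p = "\<Sum>i\<in>I. monom (c i) i"
  obtain i where i: "i \<in> I" "c i \<noteq> 0"
    using I(2) u(2,3) by (auto simp: c_def)
  have "coeff ?p i = c i"
    using I(1) i(1) by (simp add: coeff_sum)
  then have "?p \<noteq> 0"
    using i(2) by (metis coeff_0)
  moreover have "poly_matrix_vec ?p A v = 0" for v
  proof -
    have "poly_matrix_vec ?p A v = (\<Sum>i\<in>I. (u (matrix_power A i) *\<^sub>R matrix_power A i) *v v)"
      unfolding poly_matrix_vec_sum poly_matrix_vec_monom c_def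
      by (intro sum.cong refl)
        (simp add: vec_eq_iff matrix_vector_mult_def sum_distrib_left scaleR_conv_of_real[where 'a = complex] mult.assoc)
    also have "\<dots> = (\<Sum>i\<in>I. u (matrix_power A i) *\<^sub>R matrix_power A i) *v v"
      by (induction I rule: infinite_finite_induct) (simp_all add: matrix_vector_mult_add_rdistrib)
    also have "(\<Sum>i\<in>I. u (matrix_power A i) *\<^sub>R matrix_power A i) = (\<Sum>X\<in>t. u X *\<^sub>R X)"
      unfolding I(2) using inj by (subst sum.reindex) (auto intro: inj_on_subset)
    finally show ?thesis
      using u(1) by simp
  qed
  ultimately show ?thesis by blast
qed

lemma ex_annihilating_shifts:
  fixes A :: "complex ^ 'n ^ 'n"
  shows "\<exists>ls. \<forall>v. foldr (\<lambda>l w. A *v w - l *s w) ls v = 0"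
proof -
  obtain p where p: "p \<noteq> 0" "\<And>v. poly_matrix_vec p A v = 0"
    using ex_annihilating_poly by blast
  obtain L where L: "p = smult (lead_coeff p) (\<Prod>l\<in>#L. [:- l, 1:])"
    using alg_closed_imp_factorization[OF p(1)] by blast
  obtain ls where ls: "mset ls = L"
    using ex_mset by blast
  have prod: "(\<Prod>l\<in>#L. [:- l, 1:]) = (\<Prod>l\<leftarrow>ls. [:- l, 1:])"
    unfolding ls[symmetric] by (metis mset_map prod_mset_prod_list)
  have "foldr (\<lambda>l w. A *v w - l *s w) ls v = 0" for v
  proof -
    have "lead_coeff p *s foldr (\<lambda>l w. A *v w - l *s w) ls v = poly_matrix_vec p A v"
      by (subst (2) L) (simp add: poly_matrix_vec_smult prod poly_matrix_vec_prod_list)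
    then show ?thesis
      using p by (simp add: vec_eq_iff)
  qed
  then show ?thesis by blast
qed

section \<open>The spectrum is finite and nonempty\<close>

text \<open>
  On an eigenvector for \<open>\<mu>\<close> the shift \<open>A - l\<close> is multiplication by \<open>\<mu> - l\<close>, so an annihilating
  product of shifts must contain the factor with \<open>l = \<mu>\<close>.
\<close>

lemma finite_matrix_spectrum: "finite (matrix_spectrum A)"
proof -
  obtain ls where ls: "\<And>v. foldr (\<lambda>l w. A *v w - l *s w) ls v = 0"
    using ex_annihilating_shifts by blast
  have "\<mu> \<in> set ls" if \<mu>: "\<mu> \<in> matrix_spectrum A" for \<mu>
  proof -
    obtain v where v: "v \<noteq> 0" "A *v v = \<mu> *s v"
      using \<mu> by (auto simp: matrix_spectrum_def)
    have "foldr (\<lambda>l w. A *v w - l *s w) xs v = (\<Prod>l\<leftarrow>xs. \<mu> - l) *s v" for xs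
      by (induction xs)
        (simp_all add: vector_scalar_commute v(2) vector_smult_assoc left_diff_distrib
          vector_sub_rdistrib mult.commute)
    then have "(\<Prod>l\<leftarrow>ls. \<mu> - l) = 0"
      using ls[of v] v(1) by (auto simp: vec_eq_iff)
    then show ?thesis
      by (auto simp: prod_list_zero_iff)
  qed
  then show ?thesis
    by (meson finite_set finite_subset subsetI)
qed

text \<open>Without eigenvalues every shift would be injective, and so would every product of shifts.\<close>

lemma matrix_spectrum_nonempty: "matrix_spectrum A \<noteq> {}"
proof
  assume empty: "matrix_spectrum A = {}"
  obtain ls where ls: "\<And>v. foldr (\<lambda>l w. A *v w - l *s w) ls v = 0"
    using ex_annihilating_shifts by blast
  have "foldr (\<lambda>l w. A *v w - l *s w) xs v \<noteq> 0" if "v \<noteq> 0" for xs v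
    using that empty by (induction xs) (auto simp: matrix_spectrum_def)
  from this[of 1 ls] ls show False
    by (simp add: vec_eq_iff)
qed

lemma matrix_spectral_radius_less_iff:
  "matrix_spectral_radius A < r \<longleftrightarrow> (\<forall>\<mu>\<in>matrix_spectrum A. cmod \<mu> < r)"
  unfolding matrix_spectral_radius_def
  by (subst Max_less_iff) (auto simp: finite_matrix_spectrum matrix_spectrum_nonempty)

section \<open>Powers of a matrix with spectral radius below one\<close>

text \<open>
  Once \<open>\<bar>y\<bar>\<close> stays below \<open>e/2 (1 - \<bar>l\<bar>)\<close>, the ball of radius \<open>e/2\<close> is invariant under
  \<open>a \<mapsto> l a + y\<close>, and the excess over \<open>e/2\<close> decays geometrically.
\<close>

lemma perturbed_geometric_tendsto_0:
  fixes x y :: "nat \<Rightarrow> 'a::real_normed_field"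
  assumes l: "norm l < 1" and y: "y \<longlonglongrightarrow> 0" and rec: "\<And>k. x (Suc k) = l * x k + y k"
  shows "x \<longlonglongrightarrow> 0"
proof (rule LIMSEQ_I)
  fix e :: real
  assume e: "e > 0"
  let ?r = "norm l"
  have "e / 2 * (1 - ?r) > 0"
    using e l by simp
  then obtain N where N: "\<And>k. k \<ge> N \<Longrightarrow> norm (y k) < e / 2 * (1 - ?r)"
    using LIMSEQ_D[OF y, of "e / 2 * (1 - ?r)"] by auto
  have bound: "norm (x (N + j)) \<le> ?r ^ j * norm (x N) + e / 2" for j
  proof (induction j)
    case 0
    then show ?case using e by simp
  next
    case (Suc j)
    have "norm (x (N + Suc j)) \<le> ?r * norm (x (N + j)) + norm (y (N + j))"
      using norm_triangle_ineq[of "l * x (N + j)" "y (N + j)"] by (simp add: rec norm_mult)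
    also have "\<dots> \<le> ?r * (?r ^ j * norm (x N) + e / 2) + e / 2 * (1 - ?r)"
      using Suc N[of "N + j"] by (intro add_mono mult_left_mono) auto
    also have "\<dots> = ?r ^ Suc j * norm (x N) + e / 2"
      by (simp add: field_simps)
    finally show ?case .
  qed
  have "(\<lambda>j. ?r ^ j * norm (x N)) \<longlonglongrightarrow> 0"
    using l by (intro tendsto_mult_left_zero LIMSEQ_power_zero) simp
  then obtain J where J: "\<And>j. j \<ge> J \<Longrightarrow> norm (?r ^ j * norm (x N)) < e / 2"
    using LIMSEQ_D[of _ 0 "e / 2"] e by fastforce
  show "\<exists>no. \<forall>n\<ge>no. norm (x n - 0) < e"
  proof (intro exI allI impI)
    fix n
    assume n: "n \<ge> N + J"
    then have "n - N \<ge> J"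
      by simp
    have "norm (x n) \<le> ?r ^ (n - N) * norm (x N) + e / 2"
      using bound[of "n - N"] n by simp
    also have "\<dots> < e"
      using J[OF \<open>n - N \<ge> J\<close>] by simp
    finally show "norm (x n - 0) < e" by simp
  qed
qed

lemma tendsto_matrix_vector_mult:
  fixes A :: "complex ^ 'n ^ 'm"
  assumes "x \<longlonglongrightarrow> a"
  shows "(\<lambda>s. A *v x s) \<longlonglongrightarrow> A *v a"
  unfolding matrix_vector_mult_def
  by (rule vec_tendstoI) (simp, intro tendsto_intros tendsto_vec_nth assms)

text \<open>
  For \<open>x\<^sub>k = A\<^sup>k u\<close> the hypothesis says \<open>(A - l) x\<^sub>k \<longlonglongrightarrow> 0\<close>. If \<open>\<bar>l\<bar> < 1\<close>, the recursion
  \<open>x\<^sub>k\<^sub>+\<^sub>1 = l x\<^sub>k + (A - l) x\<^sub>k\<close> is a contraction with a vanishing perturbation. Otherwise \<open>l\<close> is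
  not an eigenvalue, so \<open>A - l\<close> has a left inverse, which carries the limit over to \<open>x\<^sub>k\<close>.
\<close>

lemma matrix_powers_shift_tendsto_0:
  fixes A :: "complex ^ 'n ^ 'n"
  assumes spec: "\<forall>\<mu>\<in>matrix_spectrum A. cmod \<mu> < 1"
    and lim: "(\<lambda>k. matrix_power A k *v (A *v u - l *s u)) \<longlonglongrightarrow> 0"
  shows "(\<lambda>k. matrix_power A k *v u) \<longlonglongrightarrow> 0"
proof -
  define x where "x k = matrix_power A k *v u" for k
  have shift: "matrix_power A k *v (A *v u - l *s u) = A *v x k - l *s x k" for k
    by (simp add: x_def matrix_vector_mult_diff_distrib matrix_power_commute_vec
        flip: vector_scalar_commute)
  have y: "(\<lambda>k. A *v x k - l *s x k) \<longlonglongrightarrow> 0"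
    using lim by (simp add: shift)
  have "x \<longlonglongrightarrow> 0"
  proof (cases "cmod l < 1")
    case True
    show ?thesis
    proof (rule vec_tendstoI)
      fix i
      have "(\<lambda>k. (A *v x k - l *s x k) $ i) \<longlonglongrightarrow> 0"
        using tendsto_vec_nth[OF y] by simp
      moreover have "x (Suc k) = A *v x k" for k
        by (simp add: x_def matrix_vector_mul_assoc)
      then have "x (Suc k) $ i = l * x k $ i + (A *v x k - l *s x k) $ i" for k
        by simp
      ultimately show "(\<lambda>k. x k $ i) \<longlonglongrightarrow> 0 $ i"
        using perturbed_geometric_tendsto_0[OF True, of _ "\<lambda>k. x k $ i"] by simp
    qed
  next
    case False
    have S: "(A - mat l) *v v = A *v v - l *s v" for v
    proof -
      have "mat l *v v = l *s v"
        by (simp add: vec_eq_iff matrix_vector_mult_def mat_def if_distrib[of "\<lambda>c. c * _"] cong: if_cong)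
      then show ?thesis
        by (simp add: matrix_vector_mult_diff_rdistrib)
    qed
    have "v = w" if "(A - mat l) *v v = (A - mat l) *v w" for v w
    proof (rule ccontr)
      assume "v \<noteq> w"
      moreover have "A *v (v - w) = l *s (v - w)"
        using that unfolding S
        by (simp add: matrix_vector_mult_diff_distrib vector_ssub_ldistrib algebra_simps)
      ultimately have "l \<in> matrix_spectrum A"
        unfolding matrix_spectrum_def by (auto intro!: exI[of _ "v - w"])
      then show False
        using spec False by blast
    qed
    then have "inj ((*v) (A - mat l))"
      by (rule injI)
    then obtain R where R: "R ** (A - mat l) = mat 1"
      using matrix_left_invertible_injective by blast
    have "(\<lambda>k. R *v ((A - mat l) *v x k)) \<longlonglongrightarrow> R *v 0"
      using y by (intro tendsto_matrix_vector_mult) (simp add: S)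
    then show ?thesis
      by (simp add: matrix_vector_mul_assoc R)
  qed
  then show ?thesis
    unfolding x_def .
qed

lemma matrix_powers_tendsto_0_iff:
  "(\<forall>v. (\<lambda>k. matrix_power A k *v v) \<longlonglongrightarrow> 0) \<longleftrightarrow> matrix_spectral_radius A < 1"
proof
  assume lim: "\<forall>v. (\<lambda>k. matrix_power A k *v v) \<longlonglongrightarrow> 0"
  have "cmod \<mu> < 1" if \<mu>: "\<mu> \<in> matrix_spectrum A" for \<mu>
  proof -
    obtain v where v: "v \<noteq> 0" "A *v v = \<mu> *s v"
      using \<mu> by (auto simp: matrix_spectrum_def)
    obtain i where i: "v $ i \<noteq> 0"
      using v(1) by (auto simp: vec_eq_iff)
    have "matrix_power A k *v v = \<mu> ^ k *s v" for k
      by (induction k)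
        (simp_all add: v(2) vector_smult_assoc mult.commute vector_scalar_commute
          flip: matrix_vector_mul_assoc)
    then have "(\<lambda>k. (\<mu> ^ k *s v) $ i) \<longlonglongrightarrow> 0 $ i"
      using tendsto_vec_nth[OF lim[rule_format, of v]] by simp
    then have "(\<lambda>k. \<mu> ^ k * v $ i) \<longlonglongrightarrow> 0"
      by simp
    then obtain k where k: "cmod (\<mu> ^ k * v $ i) < cmod (v $ i)"
      using LIMSEQ_D[of _ 0 "cmod (v $ i)"] i by fastforce
    then have "cmod \<mu> ^ k < 1"
      using i by (simp add: norm_mult norm_power)
    then show ?thesis
      using one_le_power[of "cmod \<mu>" k] by linarith
  qed
  then show "matrix_spectral_radius A < 1"
    by (simp add: matrix_spectral_radius_less_iff)
next
  assume "matrix_spectral_radius A < 1"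
  then have spec: "\<forall>\<mu>\<in>matrix_spectrum A. cmod \<mu> < 1"
    by (simp add: matrix_spectral_radius_less_iff)
  obtain ls where ls: "\<And>v. foldr (\<lambda>l w. A *v w - l *s w) ls v = 0"
    using ex_annihilating_shifts by blast
  have strip: "(\<lambda>k. matrix_power A k *v v) \<longlonglongrightarrow> 0"
    if "(\<lambda>k. matrix_power A k *v foldr (\<lambda>l w. A *v w - l *s w) xs v) \<longlonglongrightarrow> 0" for xs v
    using that
  proof (induction xs)
    case Nil
    then show ?case by simp
  next
    case (Cons l xs)
    have "(\<lambda>k. matrix_power A k *v foldr (\<lambda>l w. A *v w - l *s w) xs v) \<longlonglongrightarrow> 0"
      by (rule matrix_powers_shift_tendsto_0[OF spec, where l = l]) (use Cons.prems in simp)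
    then show ?case
      by (rule Cons.IH)
  qed
  show "\<forall>v. (\<lambda>k. matrix_power A k *v v) \<longlonglongrightarrow> 0"
    using strip[of ls] ls by simp
qed

lemma tensor_spectral_radius_less_iff:
  "tensor_spectral_radius M T < r \<longleftrightarrow> (\<forall>k. matrix_spectral_radius (tensor_transform M T $ k) < r)"
  unfolding tensor_spectral_radius_def by (subst Max_less_iff) auto

section \<open>The error recursion in the transform domain\<close>

lemma tensor_transform_add:
  "tensor_transform M (X + Y) = tensor_transform M X + tensor_transform M Y"
  by (simp add: tensor_transform_def vec_eq_iff distrib_right sum.distrib)

lemma tensor_transform_diff:
  "tensor_transform M (X - Y) = tensor_transform M X - tensor_transform M Y"
  by (simp add: tensor_transform_def vec_eq_iff left_diff_distrib sum_subtractf)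

lemma tendsto_tensor_transform:
  assumes "X \<longlonglongrightarrow> L"
  shows "(\<lambda>s. tensor_transform M (X s)) \<longlonglongrightarrow> tensor_transform M L"
  unfolding tensor_transform_def
  by (rule vec_tendstoI, rule vec_tendstoI, rule vec_tendstoI)
    (simp, intro tendsto_intros tendsto_vec_nth assms)

text \<open>The inverse transform is the transform by the inverse matrix, hence continuous as well.\<close>

lemma tendsto_tensor_transform_iff:
  assumes "invertible M"
  shows "(\<lambda>s. tensor_transform M (X s)) \<longlonglongrightarrow> tensor_transform M L \<longleftrightarrow> X \<longlonglongrightarrow> L"
proof
  obtain N where "N ** M = mat 1"
    using assms by (auto simp: invertible_def)
  moreover assume "(\<lambda>s. tensor_transform M (X s)) \<longlonglongrightarrow> tensor_transform M L"
  then have "(\<lambda>s. tensor_transform N (tensor_transform M (X s)))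
      \<longlonglongrightarrow> tensor_transform N (tensor_transform M L)"
    by (rule tendsto_tensor_transform)
  ultimately show "X \<longlonglongrightarrow> L"
    by (simp add: tensor_transform_inverse)
qed (rule tendsto_tensor_transform)

text \<open>
  Subtracting the fixed-point equation from the iteration cancels \<open>C\<close> and leaves the linear
  recursion of the error, which decouples into the slices.
\<close>

lemma m_iterate_error:
  assumes M: "invertible M" and L: "L = m_product M T L + C"
  shows "tensor_transform M (m_iterate M T C X0 s) $ k - tensor_transform M L $ k
    = matrix_power (tensor_transform M T $ k) s
        ** (tensor_transform M X0 $ k - tensor_transform M L $ k)"
proof (induction s)
  case 0
  then show ?case by simp
next
  case (Suc s)
  let ?t = "tensor_transform M T $ k" and ?L = "tensor_transform M L $ k"
  have "?L = ?t ** ?L + tensor_transform M C $ k"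
    using arg_cong[OF L, of "\<lambda>X. tensor_transform M X $ k"]
    by (simp add: tensor_transform_add tensor_transform_m_product[OF M])
  then have "tensor_transform M C $ k = ?L - ?t ** ?L"
    by (metis add_diff_cancel_left')
  then have "tensor_transform M (m_iterate M T C X0 (Suc s)) $ k - ?L
      = ?t ** tensor_transform M (m_iterate M T C X0 s) $ k - ?t ** ?L"
    by (simp add: tensor_transform_add tensor_transform_m_product[OF M])
  also have "\<dots> = ?t ** (tensor_transform M (m_iterate M T C X0 s) $ k - ?L)"
    by (simp add: vec_eq_iff matrix_matrix_mult_def right_diff_distrib sum_subtractf)
  finally show ?case
    by (simp add: Suc.IH matrix_mul_assoc)
qed

lemma matrix_mult_nth_column: "(A ** B) $ i $ j = (A *v column j B) $ i"
  by (simp add: matrix_matrix_mult_def matrix_vector_mult_def column_def)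

text \<open>
  The powers act on each column of the initial error separately, and the bijectivity of the transform
  allows every initial error.
\<close>

lemma m_iterate_converges_iff:
  fixes M :: "complex ^ 'p ^ 'p"
    and T :: "('m::finite, 'm, 'p::finite) tensor"
    and L C :: "('m, 'n::finite, 'p) tensor"
  assumes M: "invertible M" and L: "L = m_product M T L + C"
  shows "(\<forall>X0. tensor_converges (m_iterate M T C X0) L)
    \<longleftrightarrow> (\<forall>k v. (\<lambda>s. matrix_power (tensor_transform M T $ k) s *v v) \<longlonglongrightarrow> 0)"
proof
  let ?t = "\<lambda>k. tensor_transform M T $ k"
  assume conv: "\<forall>X0. tensor_converges (m_iterate M T C X0) L"
  show "\<forall>k v. (\<lambda>s. matrix_power (?t k) s *v v) \<longlonglongrightarrow> 0"
  proof (intro allI)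
    fix k v
    \<comment> \<open>The start whose transformed error has \<open>v\<close> as every column of every slice.\<close>
    obtain X0 where X0: "\<And>k. tensor_transform M X0 $ k = tensor_transform M L $ k + (\<chi> i j. v $ i)"
      using ex1_implies_ex[OF ex1_tensor_transform[OF M, of "\<lambda>k. tensor_transform M L $ k + (\<chi> i j. v $ i)"]]
      by blast
    let ?X = "\<lambda>s. tensor_transform M (m_iterate M T C X0 s)"
    have "m_iterate M T C X0 \<longlonglongrightarrow> L"
      using conv by (simp add: tensor_converges_iff_LIMSEQ)
    then have "?X \<longlonglongrightarrow> tensor_transform M L"
      by (rule tendsto_tensor_transform)
    then have "(\<lambda>s. ?X s $ k - tensor_transform M L $ k) \<longlonglongrightarrow> 0"
      by (intro tendsto_vec_nth LIM_zero)
    then have lim: "(\<lambda>s. matrix_power (?t k) s ** (\<chi> i (j::'n). v $ i)) \<longlonglongrightarrow> 0"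
      by (simp add: m_iterate_error[OF M L] X0)
    have entry: "(matrix_power (?t k) s ** (\<chi> i (j::'n). v $ i)) $ i $ j
        = (matrix_power (?t k) s *v v) $ i" for s i j
      by (simp add: matrix_mult_nth_column column_def)
    show "(\<lambda>s. matrix_power (?t k) s *v v) \<longlonglongrightarrow> 0"
    proof (rule vec_tendstoI)
      fix i
      \<comment> \<open>All columns agree, so an arbitrary one, here \<open>undefined\<close>, can be read off.\<close>
      show "(\<lambda>s. (matrix_power (?t k) s *v v) $ i) \<longlonglongrightarrow> 0 $ i"
        using tendsto_vec_nth[OF tendsto_vec_nth[OF lim, of i], of undefined] by (simp add: entry)
    qed
  qed
next
  let ?t = "\<lambda>k. tensor_transform M T $ k"
  assume powers: "\<forall>k v. (\<lambda>s. matrix_power (?t k) s *v v) \<longlonglongrightarrow> 0"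
  show "\<forall>X0. tensor_converges (m_iterate M T C X0) L"
  proof
    fix X0
    let ?X = "\<lambda>s. tensor_transform M (m_iterate M T C X0 s)"
    have "(\<lambda>s. ?X s - tensor_transform M L) \<longlonglongrightarrow> 0"
    proof (rule vec_tendstoI, rule vec_tendstoI, rule vec_tendstoI)
      fix k i j
      have "(\<lambda>s. (matrix_power (?t k) s
          *v column j (tensor_transform M X0 $ k - tensor_transform M L $ k)) $ i) \<longlonglongrightarrow> 0 $ i"
        by (intro tendsto_vec_nth powers[rule_format])
      then show "(\<lambda>s. (?X s - tensor_transform M L) $ k $ i $ j) \<longlonglongrightarrow> 0 $ k $ i $ j"
        using m_iterate_error[OF M L, of X0 _ k]
        by (simp flip: vector_minus_component add: matrix_mult_nth_column)
    qed
    then have "?X \<longlonglongrightarrow> tensor_transform M L"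
      by (rule LIM_zero_cancel)
    then show "tensor_converges (m_iterate M T C X0) L"
      by (simp add: tensor_converges_iff_LIMSEQ tendsto_tensor_transform_iff[OF M])
  qed
qed

section \<open>The solution is the fixed point of the iteration\<close>

lemma tensor_transform_m_inverse:
  assumes "invertible M" "m_invertible M A"
  shows "tensor_transform M A $ k ** tensor_transform M (m_inverse M A) $ k = mat 1"
    and "tensor_transform M (m_inverse M A) $ k ** tensor_transform M A $ k = mat 1"
  using is_m_inverse_m_inverse[OF assms]
    tensor_transform_m_product[OF assms(1), of A "m_inverse M A" k]
    tensor_transform_m_product[OF assms(1), of "m_inverse M A" A k]
  by (simp_all add: is_m_inverse_def tensor_transform_m_identity[OF assms(1)])

lemma solution_fixed_point:
  fixes B :: "('m::finite, 'n::finite, 'p::finite) tensor"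
  assumes M: "invertible M" and A: "m_invertible M A" and P: "m_invertible M P"
    and split: "A = P - Q"
  defines "L \<equiv> m_product M (m_inverse M A) B"
  shows "L = m_product M (m_product M (m_inverse M P) Q) L + m_product M (m_inverse M P) B"
proof (rule tensor_eqI[OF M])
  fix k
  let ?tr = "\<lambda>X. tensor_transform M X $ k"
  let ?a = "?tr A" and ?p = "?tr P" and ?q = "?tr Q" and ?b = "?tr B" and ?L = "?tr L"
    and ?r = "?tr (m_inverse M P)"
  have "?a ** ?L = ?b"
    by (simp add: L_def tensor_transform_m_product[OF M] matrix_mul_assoc
        tensor_transform_m_inverse[OF M A])
  moreover have "?p ** ?L = ?q ** ?L + ?a ** ?L"
    by (simp add: split tensor_transform_diff matrix_matrix_mult_def vec_eq_iff
        flip: sum.distrib distrib_right)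
  ultimately have "?p ** ?L = ?q ** ?L + ?b"
    by simp
  then have "?r ** (?p ** ?L) = ?r ** (?q ** ?L) + ?r ** ?b"
    by (simp add: matrix_add_ldistrib)
  then show "?L = ?tr (m_product M (m_product M (m_inverse M P) Q) L + m_product M (m_inverse M P) B)"
    by (simp add: tensor_transform_add tensor_transform_m_product[OF M] matrix_mul_assoc
        tensor_transform_m_inverse[OF M P])
qed

theorem theorem6p10:
  fixes M :: "complex ^ 'p ^ 'p"
    and A P Q T :: "('m::finite, 'm, 'p::finite) tensor"
    and B C :: "('m, 1, 'p) tensor"
  assumes "invertible M"
    and "m_invertible M A"
    and "A = P - Q"
    and "m_invertible M P"
    and "T = m_product M (m_inverse M P) Q"
    and "C = m_product M (m_inverse M P) B"
  shows "(\<forall>X0 :: ('m, 1, 'p) tensor.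
            tensor_converges (m_iterate M T C X0) (m_product M (m_inverse M A) B))
         \<longleftrightarrow> tensor_spectral_radius M T < 1"
proof -
  have "m_product M (m_inverse M A) B = m_product M T (m_product M (m_inverse M A) B) + C"
    unfolding assms(5,6) by (rule solution_fixed_point[OF assms(1,2,4,3)])
  from m_iterate_converges_iff[OF assms(1) this] show ?thesis
    by (simp add: tensor_spectral_radius_less_iff matrix_powers_tendsto_0_iff)
qed

end
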